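(* Let $\theta\in[0,1)$ be irrational, let $x\in\mathbb{R}$, let $\Sigma$ be a finite alphabet, and let $c\colon[0,1)\to\Sigma$ be a non-constant piecewise-constant function with partition boundaries $0=\gamma_0<\gamma_1<\cdots<\gamma_d=1$. Let $\mathbf{a}=a_0a_1a_2\cdots$ be the infinite word defined by $a_i=c(\{i\theta+x\})$ for $i\ge0$. Then: (1) if $\theta$ is badly approximable, then $1<\mathbf{Dio}(\mathbf{a})<\infty$; (2) if $\theta$ is well approximable, then $\mathbf{Dio}(\mathbf{a})=\infty$.
   Context: $\{\cdot\}$ denotes the fractional part. That $c$ is piecewise constant with partition boundaries $0=\gamma_0<\cdots<\gamma_d=1$ means that $c$ is constant on each interval $[\gamma_{j-1},\gamma_j)$, $1\le j\le d$. An irrational real number is badly approximable if the partial quotients of its continued fraction expansion are bounded, and well approximable otherwise. For integers $0\le r\le s$, $\mathbf{a}[r,s]$ denotes the finite word $a_ra_{r+1}\cdots a_s$. Diophantine exponent: $\mathbf{Dio}(\mathbf{a})\in[1,\infty]$ is the supremum of the real numbers $\rho$ for which there exist three sequences of integers $(r_n)_{n\ge0}$, $(s_n)_{n\ge0}$, $(t_n)_{n\ge0}$ such that, for all $n\ge 0$, $-1\le r_n<s_n<t_n$, the words $\mathbf{a}[r_n+1,r_n+t_n-s_n]$ and $\mathbf{a}[s_n+1,t_n]$ coincide, $t_n\ge\rho s_n$, and moreover $s_n-r_n\to\infty$ as $n\to\infty$. *)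

theory Defs
  imports "HOL-Analysis.Analysis"
begin

section \<open>Badly and well approximable numbers\<close>

text \<open>
  The complete quotients and partial quotients of the regular continued fraction of a real number.
  Because \<open>1 / 0 = 0\<close>, a rational number gets trailing quotients \<open>0\<close> after its finite expansion;
  below, the partial quotients are used for irrational numbers only, where no division by zero occurs.
\<close>

primrec complete_quotient :: "real \<Rightarrow> nat \<Rightarrow> real" where
  "complete_quotient x 0 = x"
| "complete_quotient x (Suc n) = 1 / frac (complete_quotient x n)"

definition partial_quotient :: "real \<Rightarrow> nat \<Rightarrow> int" where
  "partial_quotient x n = \<lfloor>complete_quotient x n\<rfloor>"

definition badly_approximable :: "real \<Rightarrow> bool" where
  "badly_approximable x \<longleftrightarrow> x \<notin> \<rat> \<and> (\<exists>M. \<forall>n. \<bar>partial_quotient x n\<bar> \<le> M)"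

definition well_approximable :: "real \<Rightarrow> bool" where
  "well_approximable x \<longleftrightarrow> x \<notin> \<rat> \<and> \<not> badly_approximable x"

section \<open>Piecewise constant functions\<close>

definition piecewise_constant :: "(real \<Rightarrow> 'a) \<Rightarrow> (nat \<Rightarrow> real) \<Rightarrow> nat \<Rightarrow> bool" where
  "piecewise_constant c \<gamma> d \<longleftrightarrow>
     \<gamma> 0 = 0 \<and> \<gamma> d = 1 \<and>
     (\<forall>j\<in>{1..d}. \<gamma> (j - 1) < \<gamma> j) \<and>
     (\<forall>j\<in>{1..d}. c constant_on {\<gamma> (j - 1)..<\<gamma> j})"

section \<open>The Diophantine exponent of an infinite word\<close>

definition subword :: "(nat \<Rightarrow> 'a) \<Rightarrow> nat \<Rightarrow> nat \<Rightarrow> 'a list" where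
  "subword a r s = map a [r..<Suc s]"

text \<open>
  The sequences are integer-valued since \<open>r n = -1\<close> is allowed. The constraints
  \<open>-1 \<le> r n < s n < t n\<close> make every argument of \<^const>\<open>nat\<close> nonnegative, so nothing is truncated.
\<close>

definition Dio_admissible :: "(nat \<Rightarrow> 'a) \<Rightarrow> real \<Rightarrow> bool" where
  "Dio_admissible a \<rho> \<longleftrightarrow>
     (\<exists>r s t :: nat \<Rightarrow> int.
        (\<forall>n. - 1 \<le> r n \<and> r n < s n \<and> s n < t n \<and>
             subword a (nat (r n + 1)) (nat (r n + t n - s n)) =
             subword a (nat (s n + 1)) (nat (t n)) \<and>
             real_of_int (t n) \<ge> \<rho> * real_of_int (s n)) \<and>
        filterlim (\<lambda>n. s n - r n) at_top sequentially)"

definition Dio :: "(nat \<Rightarrow> 'a) \<Rightarrow> ereal" where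
  "Dio a = Sup (ereal ` {\<rho>. Dio_admissible a \<rho>})"

end

theory Submission
  imports Defs
begin

text \<open>
  Let \<open>q\<close> be a convergent denominator of \<open>\<theta>\<close> and \<open>q'\<close> the next one. Shifting the word by \<open>q\<close>
  rotates the circle by the tiny amount \<open>\<parallel>q\<theta>\<parallel>\<close>, so a letter changes only next to a breakpoint, and
  since \<open>\<parallel>m\<theta>\<parallel> \<ge> \<parallel>q\<theta>\<parallel>\<close> for \<open>0 < m < q'\<close>, at most \<open>d\<close> of the first \<open>q'\<close> letters change. Among
  \<open>d + 1\<close> disjoint windows in \<open>[0, q')\<close>, one is therefore free of changes and gives a repetition.
  Windows of equal length about \<open>q / (d + 1)\<close> give exponent above 1; if \<open>q' / q \<ge> R ^ (d + 1)\<close>,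
  geometric windows \<open>[R ^ k q, R ^ (k + 1) q)\<close> give exponent of order \<open>R\<close>.

  Conversely, if \<open>\<theta>\<close> is badly approximable, a repetition with period \<open>p\<close> also has some period \<open>kp\<close>
  with \<open>k\<close> bounded and \<open>\<parallel>kp\<theta>\<parallel>\<close> small, of order at least \<open>1 / p\<close>. Within \<open>O(p)\<close> steps the orbit enters
  the interval of that length next to a jump of \<open>c\<close>, which breaks the repetition.
\<close>

section \<open>Convergents\<close>

text \<open>Indices are shifted by one: \<open>cf_den x (Suc n)\<close> is the classical q_n and
  index 0 is the conventional start q_{-1} = 0. The same holds for \<open>cf_num\<close>.\<close>

fun cf_den :: "real \<Rightarrow> nat \<Rightarrow> int" where
  "cf_den x 0 = 0"
| "cf_den x (Suc 0) = 1"
| "cf_den x (Suc (Suc n)) = partial_quotient x (Suc n) * cf_den x (Suc n) + cf_den x n"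

fun cf_num :: "real \<Rightarrow> nat \<Rightarrow> int" where
  "cf_num x 0 = 1"
| "cf_num x (Suc 0) = partial_quotient x 0"
| "cf_num x (Suc (Suc n)) = partial_quotient x (Suc n) * cf_num x (Suc n) + cf_num x n"

definition cf_err :: "real \<Rightarrow> nat \<Rightarrow> real" where
  "cf_err x n = of_int (cf_den x n) * x - of_int (cf_num x n)"

lemma complete_quotient_irrational:
  assumes "x \<notin> \<rat>"
  shows "complete_quotient x n \<notin> \<rat>"
proof (induction n)
  case 0
  then show ?case using assms by simp
next
  case (Suc n)
  have "frac (complete_quotient x n) \<in> \<rat>" if "1 / frac (complete_quotient x n) \<in> \<rat>"
    using Rats_divide[OF Rats_1 that] by simp
  then show ?case
    using Suc by auto
qed

lemma frac_complete_quotient_pos: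
  assumes "x \<notin> \<rat>"
  shows "0 < frac (complete_quotient x n)"
  using complete_quotient_irrational[OF assms, of n] Ints_subset_Rats by (auto simp: frac_gt_0_iff)

lemma complete_quotient_Suc_gt_1:
  assumes "x \<notin> \<rat>"
  shows "1 < complete_quotient x (Suc n)"
  using frac_complete_quotient_pos[OF assms, of n] frac_lt_1[of "complete_quotient x n"] by simp

lemma partial_quotient_Suc_ge_1:
  assumes "x \<notin> \<rat>"
  shows "1 \<le> partial_quotient x (Suc n)"
  using complete_quotient_Suc_gt_1[OF assms, of n] unfolding partial_quotient_def by linarith

lemma cf_den_Suc_pos_mono:
  assumes "x \<notin> \<rat>"
  shows "0 < cf_den x (Suc n) \<and> 0 \<le> cf_den x n \<and> cf_den x n \<le> cf_den x (Suc n)"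
proof (induction n)
  case 0
  then show ?case by simp
next
  case (Suc n)
  have "1 * cf_den x (Suc n) \<le> partial_quotient x (Suc n) * cf_den x (Suc n)"
    using partial_quotient_Suc_ge_1[OF assms, of n] Suc by (intro mult_right_mono) auto
  then show ?case using Suc unfolding cf_den.simps(3) by linarith
qed

lemma cf_den_Suc_ge:
  assumes "x \<notin> \<rat>"
  shows "int n \<le> cf_den x (Suc n)"
proof (induction n)
  case 0
  then show ?case by simp
next
  case (Suc n)
  show ?case
  \<comment> \<open>The recurrence adds \<open>cf_den x n\<close>, which gives the increment by 1
    only if it is positive, that is for n > 0.\<close>
  proof (cases n)
    case 0
    then show ?thesis using cf_den_Suc_pos_mono[OF assms, of "Suc 0"] by simp
  next
    case (Suc m)
    have "1 * cf_den x (Suc n) \<le> partial_quotient x (Suc n) * cf_den x (Suc n)"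
      using partial_quotient_Suc_ge_1[OF assms, of n] cf_den_Suc_pos_mono[OF assms, of n]
      by (intro mult_right_mono) auto
    moreover have "0 < cf_den x n"
      using cf_den_Suc_pos_mono[OF assms, of m] Suc by simp
    ultimately show ?thesis using Suc.IH by simp
  qed
qed

text \<open>The recurrence turns the induction hypothesis into next error = -(frac of the complete
  quotient) * current error, and the next complete quotient is the reciprocal of that fractional
  part.\<close>

lemma cf_err_Suc:
  assumes "x \<notin> \<rat>"
  shows "cf_err x (Suc n) * complete_quotient x (Suc n) = - cf_err x n"
proof (induction n)
  case 0
  show ?case
    using frac_complete_quotient_pos[OF assms, of 0]
    by (simp add: cf_err_def partial_quotient_def frac_def)
next
  case (Suc n)
  define \<alpha> where "\<alpha> = complete_quotient x (Suc n)"
  have "cf_err x (Suc (Suc n)) = of_int \<lfloor>\<alpha>\<rfloor> * cf_err x (Suc n) + cf_err x n"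
    by (simp add: cf_err_def \<alpha>_def partial_quotient_def algebra_simps)
  also have "\<dots> = - frac \<alpha> * cf_err x (Suc n)"
    using Suc unfolding \<alpha>_def[symmetric] by (simp add: frac_def algebra_simps)
  finally show ?case
    using frac_complete_quotient_pos[OF assms, of "Suc n"] by (simp add: \<alpha>_def)
qed

lemma cf_det: "cf_num x n * cf_den x (Suc n) - cf_num x (Suc n) * cf_den x n = (- 1) ^ n"
  by (induction n) (auto simp: algebra_simps)

text \<open>By \<open>cf_err_Suc\<close>, consecutive errors have a negative ratio, and the first
  error is -1.\<close>

lemma cf_err_sign:
  assumes "x \<notin> \<rat>"
  shows "cf_err x n = - ((- 1) ^ n) * \<bar>cf_err x n\<bar> \<and> cf_err x n \<noteq> 0"
proof (induction n)
  case 0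
  then show ?case by (simp add: cf_err_def)
next
  case (Suc n)
  define \<alpha> where "\<alpha> = complete_quotient x (Suc n)"
  have \<alpha>: "1 < \<alpha>" using complete_quotient_Suc_gt_1[OF assms] by (simp add: \<alpha>_def)
  have e: "cf_err x (Suc n) = - cf_err x n / \<alpha>"
    using cf_err_Suc[OF assms, of n] \<alpha> unfolding \<alpha>_def[symmetric] by (simp add: field_simps)
  then have "\<bar>cf_err x (Suc n)\<bar> = \<bar>cf_err x n\<bar> / \<alpha>"
    using \<alpha> by simp
  with e Suc \<alpha> show ?case by (cases "even n") (auto simp: field_simps)
qed

lemma abs_cf_err_Suc_le:
  assumes "x \<notin> \<rat>"
  shows "\<bar>cf_err x (Suc n)\<bar> \<le> \<bar>cf_err x n\<bar>"
proof -
  have "\<bar>cf_err x n\<bar> = \<bar>cf_err x (Suc n)\<bar> * complete_quotient x (Suc n)"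
    using cf_err_Suc[OF assms, of n] complete_quotient_Suc_gt_1[OF assms, of n]
    by (metis abs_minus_cancel abs_mult abs_of_pos less_trans zero_less_one)
  moreover have "\<bar>cf_err x (Suc n)\<bar> * 1 \<le> \<bar>cf_err x (Suc n)\<bar> * complete_quotient x (Suc n)"
    using complete_quotient_Suc_gt_1[OF assms, of n] by (intro mult_left_mono) auto
  ultimately show ?thesis by simp
qed

text \<open>This is the determinant identity with numerators expressed through errors; since errors
  alternate in sign, the difference becomes a sum of absolute values.\<close>

lemma cf_err_det:
  assumes "x \<notin> \<rat>"
  shows "of_int (cf_den x (Suc n)) * \<bar>cf_err x n\<bar> + of_int (cf_den x n) * \<bar>cf_err x (Suc n)\<bar> = 1"
proof -
  have "of_int (cf_den x (Suc n)) * cf_err x n - of_int (cf_den x n) * cf_err x (Suc n)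
      = - real_of_int (cf_num x n * cf_den x (Suc n) - cf_num x (Suc n) * cf_den x n)"
    by (simp add: cf_err_def algebra_simps)
  also have "\<dots> = - ((- 1) ^ n)"
    unfolding cf_det by simp
  finally show ?thesis
    using cf_err_sign[OF assms, of n] cf_err_sign[OF assms, of "Suc n"]
    by (cases "even n") auto
qed

text \<open>
  In the basis formed by two consecutive convergents, a denominator below the larger one has
  coordinates of opposite signs; as the errors alternate in sign, their contributions add up.
\<close>

lemma cf_best_approximation:
  fixes m h :: int
  assumes x: "x \<notin> \<rat>" and m: "0 < m" "m < cf_den x (Suc (Suc n))"
  shows "\<bar>cf_err x (Suc n)\<bar> \<le> \<bar>of_int m * x - of_int h\<bar>"
proof -
  define p q p' q' where "p = cf_num x (Suc n)" and "q = cf_den x (Suc n)"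
    and "p' = cf_num x (Suc (Suc n))" and "q' = cf_den x (Suc (Suc n))"
  define e e' where "e = cf_err x (Suc n)" and "e' = cf_err x (Suc (Suc n))"
  define D where "D = p * q' - p' * q"
  \<comment> \<open>Cramer's rule for the coordinates of (m, h); the determinant D is 1 or -1, hence
    its own inverse.\<close>
  define u v where "u = D * (h * q' - m * p')" and "v = D * (m * p - h * q)"
  have D: "D = 1 \<or> D = -1"
    using cf_det[of x "Suc n"] unfolding D_def p_def q_def p'_def q'_def
    by (cases "even n") (auto simp del: cf_num.simps cf_den.simps)
  then have DD: "D * D = 1" by auto
  have m_eq: "m = u * q + v * q'"
  proof -
    have "u * q + v * q' = D * D * m"
      unfolding u_def v_def D_def by (simp add: algebra_simps)
    then show ?thesis using DD by simp
  qed
  have h_eq: "h = u * p + v * p'"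
  proof -
    have "u * p + v * p' = D * D * h"
      unfolding u_def v_def D_def by (simp add: algebra_simps)
    then show ?thesis using DD by simp
  qed
  have q: "0 < q" "0 < q'"
    using cf_den_Suc_pos_mono[OF x] unfolding q_def q'_def by blast+
  have mq: "m < q'" using m by (simp add: q'_def)
  have ee: "e * e' < 0"
  proof -
    define A B where "A = \<bar>e\<bar>" and "B = \<bar>e'\<bar>"
    have "e = - ((- 1) ^ Suc n) * A \<and> e \<noteq> 0" "e' = - ((- 1) ^ Suc (Suc n)) * B \<and> e' \<noteq> 0"
      using cf_err_sign[OF x] unfolding e_def e'_def A_def B_def by blast+
    moreover have "0 \<le> A" "0 \<le> B" by (auto simp: A_def B_def)
    ultimately show ?thesis
      by (cases "even n") (auto simp: mult_less_0_iff)
  qed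
  have eq: "of_int m * x - of_int h = of_int u * e + of_int v * e'"
    unfolding m_eq h_eq e_def e'_def cf_err_def p_def q_def p'_def q'_def
    by (simp add: algebra_simps del: cf_num.simps cf_den.simps)
  \<comment> \<open>Otherwise m would be a multiple of q' strictly between 0 and q'.\<close>
  have u0: "u \<noteq> 0"
  proof
    assume "u = 0"
    then have "0 < v * q'" "v * q' < 1 * q'" using m_eq m(1) mq by auto
    then show False using q by (auto simp: zero_less_mult_iff)
  qed
  have uv: "u * v \<le> 0"
  proof (cases v "0 :: int" rule: linorder_cases)
    case less
    then have "v * q' < 0" using q by (simp add: mult_neg_pos)
    then have "0 < u * q" using m_eq m by linarith
    then show ?thesis using q less by (simp add: zero_less_mult_iff mult_le_0_iff)
  next
    case greater
    then have "1 * q' \<le> v * q'" using q by (intro mult_right_mono) auto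
    then have "u * q < 0" using m_eq mq by linarith
    then show ?thesis using q greater by (simp add: mult_less_0_iff mult_le_0_iff)
  qed auto
  have "0 \<le> (of_int u * e) * (of_int v * e')"
  proof -
    have "(of_int u * e) * (of_int v * e') = real_of_int (u * v) * (e * e')" by simp
    also have "\<dots> \<ge> 0" using uv ee by (intro mult_nonpos_nonpos) (auto simp del: of_int_mult)
    finally show ?thesis .
  qed
  then have "\<bar>of_int u * e + of_int v * e'\<bar> \<ge> \<bar>of_int u * e\<bar>"
    by (auto simp: zero_le_mult_iff)
  moreover have "1 * \<bar>e\<bar> \<le> \<bar>of_int u\<bar> * \<bar>e\<bar>"
    using u0 by (intro mult_right_mono) auto
  ultimately show ?thesis
    unfolding eq by (simp add: abs_mult e_def)
qed

section \<open>Approximability in terms of partial quotients\<close>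

lemma badly_approximableD:
  assumes "badly_approximable x"
  obtains \<kappa> where "0 < \<kappa>" "\<And>m h :: int. 0 < m \<Longrightarrow> \<kappa> \<le> of_int m * \<bar>of_int m * x - of_int h\<bar>"
proof -
  from assms obtain M where x: "x \<notin> \<rat>" and M: "\<And>n. \<bar>partial_quotient x n\<bar> \<le> M"
    unfolding badly_approximable_def by blast
  have M0: "0 \<le> M" using M[of 0] by linarith
  have "1 / (M + 2) \<le> of_int m * \<bar>of_int m * x - of_int h\<bar>" if m: "0 < m" for m h :: int
  proof -
    \<comment> \<open>This n locates m between consecutive denominators, so best approximation
      reduces the claim to the smaller of the two convergents.\<close>
    define n where "n = (LEAST n. m < cf_den x (Suc (Suc n)))"
    have ex: "m < cf_den x (Suc (Suc (nat m)))"
      using cf_den_Suc_ge[OF x, of "Suc (nat m)"] m by linarith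
    have n1: "m < cf_den x (Suc (Suc n))"
      unfolding n_def by (rule LeastI, rule ex)
    have n2: "cf_den x (Suc n) \<le> m"
    proof (cases n)
      case 0
      then show ?thesis using m by simp
    next
      case (Suc k)
      then have "\<not> m < cf_den x (Suc (Suc k))"
        using not_less_Least[of k "\<lambda>n. m < cf_den x (Suc (Suc n))"] unfolding n_def by auto
      then show ?thesis unfolding Suc by linarith
    qed
    define q where "q = cf_den x (Suc n)"
    define e where "e = \<bar>cf_err x (Suc n)\<bar>"
    have q0: "0 < q" "cf_den x n \<le> q"
      using cf_den_Suc_pos_mono[OF x, of n] by (auto simp: q_def)
    have "partial_quotient x (Suc n) * q \<le> M * q"
      using q0 M[of "Suc n"] by (intro mult_right_mono) auto
    then have "cf_den x (Suc (Suc n)) \<le> (M + 1) * q"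
      using q0 unfolding cf_den.simps(3) q_def[symmetric] distrib_right by linarith
    then have q'_le: "real_of_int (cf_den x (Suc (Suc n))) \<le> (M + 1) * q"
      by linarith
    have "1 = of_int (cf_den x (Suc (Suc n))) * e + q * \<bar>cf_err x (Suc (Suc n))\<bar>"
      using cf_err_det[OF x, of "Suc n"] by (simp add: e_def q_def)
    \<comment> \<open>The next denominator is at most (M + 1) q and the next error at most e;
      together they give the constant 1 / (M + 2).\<close>
    also have "\<dots> \<le> (M + 1) * q * e + q * e"
      using q'_le abs_cf_err_Suc_le[OF x, of "Suc n"] q0
      by (intro add_mono mult_right_mono mult_left_mono) (auto simp: e_def)
    also have "\<dots> = (M + 2) * (q * e)" by (simp add: algebra_simps)
    finally have "1 / (M + 2) \<le> q * e"
      using M0 by (simp add: field_simps)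
    also have "q * e \<le> m * \<bar>of_int m * x - of_int h\<bar>"
      using n2 cf_best_approximation[OF x m n1, of h] m
      by (intro mult_mono) (auto simp: q_def e_def)
    finally show ?thesis .
  qed
  moreover have "0 < 1 / (M + 2)" using M0 by simp
  ultimately show ?thesis using that by blast
qed

text \<open>A bound on all quotients beyond N, combined with the maximum of the first ones, would
  bound them all. The demand N < n later forces large denominators.\<close>

lemma well_approximable_large_quotient:
  assumes "well_approximable x"
  obtains n where "N < n" "T \<le> partial_quotient x n"
proof (rule ccontr)
  note found = that
  assume no: "\<not> thesis"
  then have small: "partial_quotient x n < T" if n: "N < n" for n
    using found no n by (meson not_less)
  have x: "x \<notin> \<rat>" using assms by (simp add: well_approximable_def)
  define M where "M = Max ((\<lambda>n. \<bar>partial_quotient x n\<bar>) ` {..N}) + \<bar>T\<bar>"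
  have Mx: "\<bar>partial_quotient x n\<bar> \<le> Max ((\<lambda>n. \<bar>partial_quotient x n\<bar>) ` {..N})" if "n \<le> N" for n
    using that by (intro Max_ge) auto
  have "\<bar>partial_quotient x n\<bar> \<le> M" for n
  proof (cases "n \<le> N")
    case True
    then show ?thesis using Mx[of n] unfolding M_def by linarith
  next
    case False
    then obtain k where "n = Suc k" by (cases n) auto
    then have "1 \<le> partial_quotient x n" using partial_quotient_Suc_ge_1[OF x] by simp
    moreover have "partial_quotient x n < T" using small False by simp
    ultimately show ?thesis using Mx[of 0] unfolding M_def by linarith
  qed
  then have "badly_approximable x" using x unfolding badly_approximable_def by blast
  then show False using assms by (simp add: well_approximable_def)
qed

section \<open>Rotations and piecewise constant functions\<close>

lemma piecewise_constant_less:
  assumes "piecewise_constant c \<gamma> d" "j < d"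
  shows "\<gamma> j < \<gamma> (Suc j)"
proof -
  have "\<forall>k\<in>{1..d}. \<gamma> (k - 1) < \<gamma> k" using assms(1) by (simp add: piecewise_constant_def)
  from bspec[OF this, of "Suc j"] show ?thesis using assms(2) by simp
qed

lemma piecewise_constant_mono:
  assumes "piecewise_constant c \<gamma> d" "i \<le> j" "j \<le> d"
  shows "\<gamma> i \<le> \<gamma> j"
  using assms(2,3)
proof (induction j rule: dec_induct)
  case (step j)
  then show ?case using piecewise_constant_less[OF assms(1), of j] by simp
qed simp

lemma piecewise_constant_bounds:
  assumes "piecewise_constant c \<gamma> d" "j \<le> d"
  shows "0 \<le> \<gamma> j" "\<gamma> j \<le> 1"
  using piecewise_constant_mono[OF assms(1), of 0 j] piecewise_constant_mono[OF assms(1), of j d] assms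
  by (auto simp: piecewise_constant_def)

lemma piecewise_constant_eq:
  assumes "piecewise_constant c \<gamma> d" "j < d"
    and "y \<in> {\<gamma> j..<\<gamma> (Suc j)}" "z \<in> {\<gamma> j..<\<gamma> (Suc j)}"
  shows "c y = c z"
proof -
  have "c constant_on {\<gamma> (Suc j - 1)..<\<gamma> (Suc j)}"
    using assms(1,2) unfolding piecewise_constant_def by (metis Suc_leI atLeastAtMost_iff le_add1 plus_1_eq_Suc)
  then show ?thesis using assms(3,4) unfolding constant_on_def by auto
qed

lemma piecewise_constant_cell:
  assumes "piecewise_constant c \<gamma> d" "0 \<le> y" "y < 1"
  obtains j where "j < d" "y \<in> {\<gamma> j..<\<gamma> (Suc j)}"
proof -
  define k where "k = (LEAST k. y < \<gamma> k)"
  have d: "y < \<gamma> d" "\<gamma> 0 = 0" using assms by (auto simp: piecewise_constant_def)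
  have k: "y < \<gamma> k" "k \<le> d"
    unfolding k_def using d by (auto intro: LeastI Least_le)
  then obtain j where j: "k = Suc j" using d assms(2) by (cases k) auto
  then have "\<not> y < \<gamma> j"
    using not_less_Least[of j "\<lambda>k. y < \<gamma> k"] unfolding k_def by simp
  then show ?thesis using that[of j] j k by simp
qed

text \<open>If the right end of the cell of \<open>frac y\<close>, lifted by the integer part of y,
  lay beyond z, both points would share a cell. The end z is included because a breakpoint belongs
  to the cell on its right. Only \<open>Suc j\<close> occurs, so 0 and 1 count as one breakpoint
  modulo 1.\<close>

lemma piecewise_constant_breakpoint_between:
  assumes pc: "piecewise_constant c \<gamma> d" and yz: "y < z" and neq: "c (frac y) \<noteq> c (frac z)"
  obtains j and N :: int where "j < d" "y < \<gamma> (Suc j) + of_int N" "\<gamma> (Suc j) + of_int N \<le> z"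
proof -
  obtain j where j: "j < d" "frac y \<in> {\<gamma> j..<\<gamma> (Suc j)}"
    using piecewise_constant_cell[OF pc, of "frac y"] frac_lt_1[of y] by auto
  have "\<gamma> (Suc j) + of_int \<lfloor>y\<rfloor> \<le> z"
  proof (rule ccontr)
    assume less: "\<not> ?thesis"
    define z' where "z' = z - of_int \<lfloor>y\<rfloor>"
    have z': "z' \<in> {\<gamma> j..<\<gamma> (Suc j)}"
      using less yz j by (auto simp: z'_def frac_def)
    then have "0 \<le> z'" "z' < 1"
      using piecewise_constant_bounds[OF pc, of j] piecewise_constant_bounds[OF pc, of "Suc j"] j by auto
    then have "frac z = z'"
      unfolding frac_unique_iff by (simp add: z'_def)
    then show False
      using piecewise_constant_eq[OF pc j(1,2) z'] neq by simp
  qed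
  moreover have "y < \<gamma> (Suc j) + of_int \<lfloor>y\<rfloor>" using j by (simp add: frac_def)
  ultimately show ?thesis using that j by blast
qed

text \<open>The jump is sought at an interior breakpoint, so that small shifts across it do not wrap
  around the circle.\<close>

lemma piecewise_constant_jump:
  assumes pc: "piecewise_constant c \<gamma> d" and nonconst: "\<not> c constant_on {0..<1}"
  obtains j where "Suc j < d" "c (\<gamma> j) \<noteq> c (\<gamma> (Suc j))"
proof (rule ccontr)
  note found = that
  assume "\<not> thesis"
  then have eq: "c (\<gamma> j) = c (\<gamma> (Suc j))" if "Suc j < d" for j
    using that found by blast
  have c0: "j < d \<Longrightarrow> c (\<gamma> j) = c (\<gamma> 0)" for j
    by (induction j) (auto simp: eq)
  have "c y = c (\<gamma> 0)" if y: "y \<in> {0..<1}" for y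
  proof -
    obtain j where j: "j < d" "y \<in> {\<gamma> j..<\<gamma> (Suc j)}"
      using piecewise_constant_cell[OF pc, of y] y by auto
    have "\<gamma> j \<in> {\<gamma> j..<\<gamma> (Suc j)}" using j by simp
    from piecewise_constant_eq[OF pc j this] show ?thesis using c0[OF j(1)] by simp
  qed
  then show False using nonconst unfolding constant_on_def by blast
qed

text \<open>
  A mismatch at \<open>i\<close> puts \<open>i\<theta> + x\<close>, modulo 1, in a half-open interval of length \<open>\<bar>cf_err \<theta> (Suc n)\<bar>\<close>
  next to a breakpoint. By the best approximation property, two of the first \<open>cf_den \<theta> (n + 2)\<close>
  orbit points never lie in the same such interval.
\<close>

lemma card_mismatches_le:
  assumes \<theta>: "\<theta> \<notin> \<rat>" and pc: "piecewise_constant c \<gamma> d"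
    and a: "\<And>i. a i = c (frac (real i * \<theta> + x))"
    and q: "int q = cf_den \<theta> (Suc n)"
  defines "B \<equiv> {i. int i < cf_den \<theta> (Suc (Suc n)) \<and> a (i + q) \<noteq> a i}"
  shows "finite B" "card B \<le> d"
proof -
  have "B \<subseteq> {..nat (cf_den \<theta> (Suc (Suc n)))}"
    unfolding B_def by auto
  then show "finite B" by (rule finite_subset) simp
  define e where "e = cf_err \<theta> (Suc n)"
  define y where "y i = real i * \<theta> + x" for i
  \<comment> \<open>\<open>min\<close> and \<open>max\<close> treat both signs of the error e at
    once.\<close>
  define P where "P i j \<longleftrightarrow> j < d \<and> (\<exists>N :: int. min (y i) (y i + e) < \<gamma> (Suc j) + of_int N
      \<and> \<gamma> (Suc j) + of_int N \<le> max (y i) (y i + e))" for i j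
  have e0: "e \<noteq> 0" using cf_err_sign[OF \<theta>] unfolding e_def by blast
  have "\<exists>j. P i j" if "i \<in> B" for i
  proof -
    have "real q = of_int (cf_den \<theta> (Suc n))" by (simp flip: q)
    then have "real (i + q) * \<theta> + x = y i + e + of_int (cf_num \<theta> (Suc n))"
      by (simp add: y_def e_def cf_err_def algebra_simps del: cf_num.simps cf_den.simps)
    then have "a (i + q) = c (frac (y i + e))"
      unfolding a by (simp del: cf_num.simps)
    then have ne: "c (frac (y i)) \<noteq> c (frac (y i + e))"
      using that unfolding B_def a y_def by auto
    show ?thesis
    proof (cases "0 < e")
      case True
      then show ?thesis
        using piecewise_constant_breakpoint_between[OF pc, of "y i" "y i + e"] ne
        unfolding P_def by (metis less_add_same_cancel1 max.absorb4 min.absorb3)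
    next
      case False
      then have "y i + e < y i" using e0 by simp
      then show ?thesis
        using piecewise_constant_breakpoint_between[OF pc, of "y i + e" "y i"] ne
        unfolding P_def by (metis max.absorb3 min.absorb4)
    qed
  qed
  then obtain f where f: "P i (f i)" if "i \<in> B" for i by metis
  have no: False if ii: "i < i'" "i' \<in> B" "P i j" "P i' j" for i i' j
  proof -
    obtain N where N: "min (y i) (y i + e) < \<gamma> (Suc j) + of_int N"
      "\<gamma> (Suc j) + of_int N \<le> max (y i) (y i + e)"
      using ii(3) unfolding P_def by blast
    obtain N' where N': "min (y i') (y i' + e) < \<gamma> (Suc j) + of_int N'"
      "\<gamma> (Suc j) + of_int N' \<le> max (y i') (y i' + e)"
      using ii(4) unfolding P_def by blast
    \<comment> \<open>Strict because the interval is half-open; this is what contradicts the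
      non-strict best approximation bound.\<close>
    have "\<bar>(y i' - y i) - of_int (N' - N)\<bar> < \<bar>e\<bar>"
      using N N' by (auto simp: min_def max_def split: if_splits)
    moreover have "y i' - y i = of_int (int i' - int i) * \<theta>"
      by (simp add: y_def algebra_simps)
    moreover have "\<bar>e\<bar> \<le> \<bar>of_int (int i' - int i) * \<theta> - of_int (N' - N)\<bar>"
      unfolding e_def using ii(1,2) by (intro cf_best_approximation[OF \<theta>]) (auto simp: B_def)
    ultimately show False by linarith
  qed
  have "inj_on f B"
  proof (rule inj_onI)
    fix i i' assume "i \<in> B" "i' \<in> B" "f i = f i'"
    then show "i = i'"
      using f no[of i i' "f i"] no[of i' i "f i"] by (metis linorder_neqE_nat)
  qed
  moreover have "f ` B \<subseteq> {..<d}" using f unfolding P_def by auto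
  ultimately show "card B \<le> d" using card_inj_on_le[of f B "{..<d}"] by simp
qed

section \<open>Windows free of mismatches, by the pigeonhole principle\<close>

lemma exists_disjoint_window:
  assumes "finite B" "card B \<le> d" "disjoint_family_on W {..d}"
  obtains k where "k \<le> d" "W k \<inter> B = {}"
proof (rule ccontr)
  assume no: "\<not> thesis"
  then have "\<forall>k\<in>{..d}. \<exists>i. i \<in> W k \<inter> B" using that by blast
  then obtain f where f: "\<And>k. k \<le> d \<Longrightarrow> f k \<in> W k \<inter> B" by (metis atMost_iff)
  have "inj_on f {..d}"
  proof (rule inj_onI)
    fix k k' assume "k \<in> {..d}" "k' \<in> {..d}" "f k = f k'"
    moreover from this have "f k \<in> W k \<inter> W k'" using f[of k] f[of k'] by simp
    ultimately show "k = k'" using assms(3) unfolding disjoint_family_on_def by blast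
  qed
  moreover have "f ` {..d} \<subseteq> B" using f by auto
  ultimately have "card {..d} \<le> card B" using assms(1) card_inj_on_le by blast
  then show False using assms(2) by simp
qed

text \<open>The endpoints w are left general so that both arithmetic and geometric progressions of
  windows can be used.\<close>

lemma exists_matching_window:
  assumes \<theta>: "\<theta> \<notin> \<rat>" and pc: "piecewise_constant c \<gamma> d"
    and a: "\<And>i. a i = c (frac (real i * \<theta> + x))"
    and q: "int q = cf_den \<theta> (Suc n)"
    and w: "mono w" "int (w (Suc d)) \<le> cf_den \<theta> (Suc (Suc n))"
  obtains k where "k \<le> d" "\<And>i. w k \<le> i \<Longrightarrow> i < w (Suc k) \<Longrightarrow> a (i + q) = a i"
proof -
  define B where "B = {i. int i < cf_den \<theta> (Suc (Suc n)) \<and> a (i + q) \<noteq> a i}"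
  have "disjoint_family (\<lambda>k. {w k..<w (Suc k)})"
    unfolding disjoint_family_on_def
  proof (intro ballI impI)
    fix m n :: nat assume "m \<noteq> n"
    then consider "Suc m \<le> n" | "Suc n \<le> m" by linarith
    then show "{w m..<w (Suc m)} \<inter> {w n..<w (Suc n)} = {}"
      using monoD[OF w(1), of "Suc m" n] monoD[OF w(1), of "Suc n" m] by cases auto
  qed
  then have "disjoint_family_on (\<lambda>k. {w k..<w (Suc k)}) {..d}"
    by (rule disjoint_family_on_mono[rotated]) simp
  then obtain k where k: "k \<le> d" "{w k..<w (Suc k)} \<inter> B = {}"
    using exists_disjoint_window[of B d] card_mismatches_le[OF \<theta> pc a q] unfolding B_def by blast
  have "a (i + q) = a i" if i: "w k \<le> i" "i < w (Suc k)" for i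
  proof -
    have "w (Suc k) \<le> w (Suc d)" using k(1) by (intro monoD[OF w(1)]) simp
    then have "int i < cf_den \<theta> (Suc (Suc n))" using i w(2) by linarith
    then show ?thesis using k(2) i unfolding B_def by auto
  qed
  then show ?thesis using that k by blast
qed

text \<open>
  Take \<open>q \<le> Q\<close> and \<open>p\<close> coprime with \<open>\<bar>q\<theta> - p\<bar> < 1 / Q\<close>: then \<open>q\<close> orbit points in a row are
  \<open>1 / Q\<close>-close to a translate of the multiples of \<open>1 / q\<close>, and bad approximability
  makes \<open>q\<close> comparable to \<open>Q\<close>.
\<close>

lemma orbit_hits_interval:
  assumes \<kappa>: "0 < \<kappa>" "\<And>m h :: int. 0 < m \<Longrightarrow> \<kappa> \<le> of_int m * \<bar>of_int m * \<theta> - of_int h\<bar>"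
    and Q: "0 < Q" "(1 / \<kappa> + 2) / real Q \<le> \<beta> - \<alpha>" and ab: "0 \<le> \<alpha>" "\<beta> \<le> 1"
  obtains i where "i0 \<le> i" "i < i0 + Q" "frac (real i * \<theta> + x) \<in> {\<alpha>..<\<beta>}"
proof -
  obtain p q :: int where pq: "coprime p q" "0 < q" "q \<le> int Q"
      and e: "\<bar>of_int q * \<theta> - of_int p\<bar> < 1 / real Q"
    by (rule Dirichlet_approx_coprime[OF Q(1)])
  define e where "e = of_int q * \<theta> - of_int p"
  \<comment> \<open>This yields 1 / q <= 1 / (\<kappa> Q), so the interval has room for one spacing
    1 / q and a margin 1 / Q at each end.\<close>
  have "\<kappa> \<le> of_int q * \<bar>e\<bar>" unfolding e_def using \<kappa>(2) pq by blast
  also have "\<dots> \<le> of_int q * (1 / real Q)"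
    using e pq by (intro mult_left_mono) (auto simp: e_def)
  finally have "1 / of_int q \<le> 1 / (\<kappa> * Q)"
    using pq Q(1) \<kappa>(1) by (simp add: field_simps)
  then have "\<alpha> + 2 / Q + 1 / of_int q \<le> \<beta>"
    using Q(2) by (simp add: add_divide_distrib algebra_simps)
  moreover have "2 / real Q = 1 / Q + 1 / Q" by simp
  ultimately have len: "\<alpha> + (1 / Q + 1 / Q) + 1 / of_int q \<le> \<beta>" by metis
  define z where "z = real i0 * \<theta> + x"
  \<comment> \<open>The first grid point z + m / q at or after \<alpha> + 1 / Q.\<close>
  define m where "m = \<lceil>of_int q * (\<alpha> + 1 / Q - z)\<rceil>"
  have "of_int q * (\<alpha> + 1 / Q - z) \<le> of_int m" "of_int m < of_int q * (\<alpha> + 1 / Q - z) + 1"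
    unfolding m_def by linarith+
  then have "\<alpha> + 1 / Q - z \<le> of_int m / of_int q" "of_int m / of_int q < \<alpha> + 1 / Q - z + 1 / of_int q"
    using pq(2) by (simp_all add: pos_le_divide_eq pos_divide_less_eq distrib_left distrib_right mult.commute[of _ "of_int q"])
  then have m: "\<alpha> + 1 / Q \<le> z + of_int m / of_int q" "z + of_int m / of_int q < \<alpha> + 1 / Q + 1 / of_int q"
    by linarith+
  obtain u v where uv: "u * p + v * q = 1"
    using bezout_int[of p q] pq(1) by auto
  \<comment> \<open>By Bezout, u inverts p modulo q, so j p is congruent to m and j steps from z
    lead near the chosen grid point.\<close>
  define j where "j = (m * u) mod q"
  define N where "N = - ((m * u) div q * p + m * v)"
  have "j * p = m * (u * p + v * q) + q * N"
    unfolding j_def N_def minus_div_mult_eq_mod[symmetric] by (simp add: algebra_simps)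
  then have jp: "j * p = m + q * N" using uv by simp
  have j: "0 \<le> j" "j < q" using pq(2) by (auto simp: j_def)
  \<comment> \<open>The error of replacing \<theta> by p / q over j steps; since j < q it stays
    below the margin 1 / Q.\<close>
  define \<delta> where "\<delta> = of_int j * e / of_int q"
  define y where "y = z + of_int m / of_int q + \<delta>"
  define i where "i = i0 + nat j"
  have "of_int j * \<theta> = of_int (j * p) / of_int q + \<delta>"
    using pq(2) by (simp add: \<delta>_def e_def field_simps)
  also have "real_of_int (j * p) / of_int q = of_int m / of_int q + of_int N"
    unfolding jp using pq(2) by (simp add: add_divide_distrib)
  finally have "z + of_int j * \<theta> = y + of_int N" unfolding y_def by linarith
  moreover have "real i * \<theta> + x = z + of_int j * \<theta>"
    using j by (simp add: i_def z_def distrib_right)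
  ultimately have iy: "real i * \<theta> + x = y + of_int N" by simp
  have "\<bar>\<delta>\<bar> = (of_int j / of_int q) * \<bar>e\<bar>"
    using j pq(2) by (simp add: \<delta>_def abs_mult)
  also have "\<dots> \<le> 1 * \<bar>e\<bar>"
    using j by (intro mult_right_mono) (auto simp: field_simps)
  also have "\<dots> < 1 / Q" using e by (simp add: e_def)
  finally have "- (1 / Q) < \<delta>" "\<delta> < 1 / Q" by linarith+
  then have "\<alpha> \<le> y" "y < \<beta>" using m len unfolding y_def by linarith+
  moreover from this have "frac y = y" using ab by (simp add: frac_eq)
  ultimately have "frac (real i * \<theta> + x) \<in> {\<alpha>..<\<beta>}" by (simp add: iy)
  moreover have "i0 \<le> i" "i < i0 + Q" using j pq by (auto simp: i_def)
  ultimately show ?thesis using that by blast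
qed

text \<open>
  The shift \<open>p\<theta>\<close> may be close to a period of \<open>c\<close>; some multiple \<open>kp\<theta>\<close> with \<open>k\<close> bounded is
  instead close to an integer, and a shift that small creates mismatches next to a jump of \<open>c\<close>.
\<close>

lemma repetition_length_le:
  assumes bad: "badly_approximable \<theta>" and pc: "piecewise_constant c \<gamma> d"
    and nonconst: "\<not> c constant_on {0..<1}"
    and a: "\<And>i. a i = c (frac (real i * \<theta> + x))"
  obtains C :: real where "0 < C"
    "\<And>i p L. 0 < p \<Longrightarrow> (\<And>j. j < L \<Longrightarrow> a (i + j + p) = a (i + j)) \<Longrightarrow> real L \<le> C * real p"
proof -
  obtain \<kappa> where \<kappa>: "0 < \<kappa>" "\<And>m h :: int. 0 < m \<Longrightarrow> \<kappa> \<le> of_int m * \<bar>of_int m * \<theta> - of_int h\<bar>"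
    using badly_approximableD[OF bad] by blast
  obtain g where g: "Suc g < d" "c (\<gamma> g) \<noteq> c (\<gamma> (Suc g))"
    using piecewise_constant_jump[OF pc nonconst] by blast
  have gaps: "\<gamma> g < \<gamma> (Suc g)" "\<gamma> (Suc g) < \<gamma> (Suc (Suc g))"
    using piecewise_constant_less[OF pc] g(1) by auto
  have in01: "0 \<le> \<gamma> g" "\<gamma> (Suc (Suc g)) \<le> 1"
    using piecewise_constant_bounds[OF pc] g(1) by auto
  \<comment> \<open>A shift below this size moves a point across the jump without leaving the two
    adjacent cells.\<close>
  define \<eta> where "\<eta> = min (\<gamma> (Suc g) - \<gamma> g) (\<gamma> (Suc (Suc g)) - \<gamma> (Suc g))"
  have "0 < \<eta>" using gaps by (simp add: \<eta>_def)
  then obtain K :: nat where K: "0 < K" "1 / real K < \<eta>"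
    using ex_inverse_of_nat_less[of \<eta>] by (auto simp: divide_inverse)
  have left: "c y = c (\<gamma> g)" if "\<gamma> g \<le> y" "y < \<gamma> (Suc g)" for y
    using piecewise_constant_eq[OF pc, of g y "\<gamma> g"] that g(1) by auto
  have right: "c y = c (\<gamma> (Suc g))" if "\<gamma> (Suc g) \<le> y" "y < \<gamma> (Suc (Suc g))" for y
    using piecewise_constant_eq[OF pc, of "Suc g" y "\<gamma> (Suc g)"] that g(1) by auto
  \<comment> \<open>Chosen so that (1 / \<kappa> + 2) / (C p) equals \<kappa> / (K p), the lower
    bound found below for the shift e. Thus about C p orbit steps meet an interval of length
    |e|.\<close>
  define C where "C = (1 / \<kappa> + 2) * K / \<kappa>"
  have C: "0 < C"
    unfolding C_def using \<kappa>(1) K by (intro mult_pos_pos divide_pos_pos add_pos_pos) auto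
  have "real L \<le> (C + 1 + K) * real p"
    if p: "0 < p" and rep: "\<And>j. j < L \<Longrightarrow> a (i0 + j + p) = a (i0 + j)" for i0 p L
  proof -
    obtain h k :: int where k: "0 < k" "k \<le> int K"
        and hk: "\<bar>of_int k * (real p * \<theta>) - of_int h\<bar> < 1 / real K"
      by (rule Dirichlet_approx[OF K(1)])
    define s where "s = nat k * p"
    define e where "e = real s * \<theta> - of_int h"
    have s0: "0 < s" "s \<le> K * p" using k p by (auto simp: s_def)
    have sK: "real s \<le> K * p" using s0(2) by (metis of_nat_le_iff of_nat_mult)
    have e_small: "\<bar>e\<bar> < \<eta>" using hk K(2) k by (simp add: e_def s_def mult.assoc)
    have "\<kappa> \<le> real s * \<bar>e\<bar>"
      using \<kappa>(2)[of "int s" h] s0 by (simp add: e_def)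
    also have "\<dots> \<le> (K * p) * \<bar>e\<bar>" using sK by (intro mult_right_mono) auto
    finally have e_ge: "\<kappa> / (K * p) \<le> \<bar>e\<bar>" using K p by (simp add: field_simps)
    define Q where "Q = nat \<lceil>C * p\<rceil>"
    have Q: "C * p \<le> Q" "Q \<le> C * p + 1" "0 < Q"
      using C p by (auto simp: Q_def) 
    have "(1 / \<kappa> + 2) / Q \<le> (1 / \<kappa> + 2) / (C * p)"
      using Q C p \<kappa>(1) by (intro divide_left_mono) auto
    also have "\<dots> = \<kappa> / (K * p)"
      using \<kappa>(1) K p by (simp add: C_def divide_simps)
    finally have Q_len: "(1 / \<kappa> + 2) / Q \<le> \<bar>e\<bar>" using e_ge by linarith
    have "L < Q + s"
    proof (rule ccontr)
      assume "\<not> L < Q + s"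
      then have L: "Q + s \<le> L" by simp
      \<comment> \<open>The period p is applied k times; every intermediate index stays within the
        repetition because Q + s <= L.\<close>
      have a_eq: "a (i + s) = a i" if i: "i0 \<le> i" "i < i0 + Q" for i
      proof -
        have "a (i + l * p) = a i" if "l \<le> nat k" for l
          using that
        proof (induction l)
          case (Suc l)
          have "l * p \<le> s" unfolding s_def using Suc by (intro mult_right_mono) auto
          then have "a (i0 + (i - i0 + l * p) + p) = a (i0 + (i - i0 + l * p))"
            using i L by (intro rep) auto
          then show ?case using Suc i by (simp add: algebra_simps)
        qed simp
        then show ?thesis unfolding s_def by simp
      qed
      have shift: "a (i + s) = c (frac (frac (real i * \<theta> + x) + e))" for i
      proof -
        have "real (i + s) * \<theta> + x = (real i * \<theta> + x + e) + of_int h"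
          by (simp add: e_def algebra_simps)
        then show ?thesis unfolding a by (simp only: frac_add_simps frac_add_of_int_right)
      qed
      have eL: "\<gamma> g < \<gamma> (Suc g) - \<bar>e\<bar>" and eR: "\<gamma> (Suc g) + \<bar>e\<bar> < \<gamma> (Suc (Suc g))"
        using e_small unfolding \<eta>_def by linarith+
      have "0 < \<kappa> / (K * p)" using \<kappa>(1) K p by simp
      then have "e \<noteq> 0" using e_ge by linarith
      \<comment> \<open>The target interval lies just left of the jump if e > 0 and starts at the
        jump if e < 0; adding e then crosses the jump.\<close>
      then consider "0 < e" | "e < 0" by linarith
      then show False
      proof cases
        case 1
        then obtain i where i: "i0 \<le> i" "i < i0 + Q"
          and y: "frac (real i * \<theta> + x) \<in> {\<gamma> (Suc g) - e..<\<gamma> (Suc g)}"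
          using orbit_hits_interval[OF \<kappa> Q(3), of "\<gamma> (Suc g)" "\<gamma> (Suc g) - e" i0 x]
            Q_len eL eR in01 by force
        define y where "y = frac (real i * \<theta> + x)"
        have "frac (y + e) = y + e"
          unfolding frac_eq using y 1 eL eR in01 by (auto simp: y_def)
        then have "c (y + e) = c y"
          using a_eq[OF i] shift[of i] a[of i] by (simp add: y_def)
        moreover have "c y = c (\<gamma> g)"
          using y 1 eL by (intro left) (auto simp: y_def)
        moreover have "c (y + e) = c (\<gamma> (Suc g))"
          using y 1 eR by (intro right) (auto simp: y_def)
        ultimately show False using g(2) by simp
      next
        case 2
        then obtain i where i: "i0 \<le> i" "i < i0 + Q"
          and y: "frac (real i * \<theta> + x) \<in> {\<gamma> (Suc g)..<\<gamma> (Suc g) - e}"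
          using orbit_hits_interval[OF \<kappa> Q(3), of "\<gamma> (Suc g) - e" "\<gamma> (Suc g)" i0 x]
            Q_len eL eR in01 by force
        define y where "y = frac (real i * \<theta> + x)"
        have "frac (y + e) = y + e"
          unfolding frac_eq using y 2 eL eR in01 by (auto simp: y_def)
        then have "c (y + e) = c y"
          using a_eq[OF i] shift[of i] a[of i] by (simp add: y_def)
        moreover have "c y = c (\<gamma> (Suc g))"
          using y 2 eR by (intro right) (auto simp: y_def)
        moreover have "c (y + e) = c (\<gamma> g)"
          using y 2 eL by (intro left) (auto simp: y_def)
        ultimately show False using g(2) by simp
      qed
    qed
    then have "real L \<le> Q + real s" by linarith
    also have "\<dots> \<le> C * p + 1 + K * p" using Q(2) sK by linarith
    also have "\<dots> \<le> C * p + 1 * p + K * p" using p by simp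
    also have "\<dots> = (C + 1 + K) * p" by (simp add: algebra_simps)
    finally show ?thesis .
  qed
  moreover have "0 < C + 1 + K" using C by linarith
  ultimately show ?thesis using that by blast
qed

section \<open>Bounds on the Diophantine exponent\<close>

text \<open>
  Here \<open>i\<close> is the start of the earlier occurrence, \<open>p\<close> the distance between the occurrences and
  \<open>L\<close> their length: \<open>i = r + 1\<close>, \<open>p = s - r\<close>, \<open>L = t - s\<close>.
\<close>

lemma Dio_admissible_iff:
  "Dio_admissible a \<rho> \<longleftrightarrow>
    (\<forall>B. \<exists>i p L. B \<le> p \<and> 0 < p \<and> 0 < L \<and> (\<forall>j<L. a (i + j + p) = a (i + j)) \<and>
      \<rho> * (real (i + p) - 1) \<le> real (i + p + L) - 1)"
  (is "_ \<longleftrightarrow> (\<forall>B. \<exists>i p L. ?R B i p L)")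
proof -
  have subword_eq: "subword a i (nat (int i + int L - 1)) = subword a (i + p) (nat (int i + int p + int L - 1)) \<longleftrightarrow>
      (\<forall>j<L. a (i + j + p) = a (i + j))" if "0 < L" for i p L
  proof -
    have "Suc (nat (int i + int L - 1)) = i + L"
      "Suc (nat (int i + int p + int L - 1)) = i + p + L" using that by auto
    then show ?thesis
      unfolding subword_def by (auto simp: list_eq_iff_nth_eq add_ac)
  qed
  show ?thesis
  proof
    assume "Dio_admissible a \<rho>"
    then obtain r s t :: "nat \<Rightarrow> int" where rst: "\<And>n. - 1 \<le> r n \<and> r n < s n \<and> s n < t n \<and>
        subword a (nat (r n + 1)) (nat (r n + t n - s n)) = subword a (nat (s n + 1)) (nat (t n)) \<and>
        real_of_int (t n) \<ge> \<rho> * real_of_int (s n)"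
      and lim: "filterlim (\<lambda>n. s n - r n) at_top sequentially"
      unfolding Dio_admissible_def by blast
    show "\<forall>B. \<exists>i p L. ?R B i p L"
    proof
      fix B :: nat
      have "\<forall>\<^sub>F n in sequentially. int B \<le> s n - r n"
        using lim by (simp add: filterlim_at_top)
      then obtain n where n: "int B \<le> s n - r n"
        using eventually_happens'[OF sequentially_bot] by blast
      define i p L where "i = nat (r n + 1)" and "p = nat (s n - r n)" and "L = nat (t n - s n)"
      have ipL: "r n = int i - 1" "s n = int i + int p - 1" "t n = int i + int p + int L - 1"
        and pos: "0 < p" "0 < L"
        using rst[of n] by (auto simp: i_def p_def L_def)
      have "nat (s n + 1) = i + p" "nat (r n + 1) = i" "r n + t n - s n = int i + int L - 1"
        unfolding ipL by auto
      then have "subword a i (nat (int i + int L - 1)) = subword a (i + p) (nat (int i + int p + int L - 1))"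
        using rst[of n] by (metis ipL(3))
      then have "\<forall>j<L. a (i + j + p) = a (i + j)" using subword_eq pos by blast
      moreover have "\<rho> * (real (i + p) - 1) \<le> real (i + p + L) - 1"
        using rst[of n] by (simp add: ipL)
      moreover have "B \<le> p" using n ipL by simp
      ultimately show "\<exists>i p L. ?R B i p L" using pos by blast
    qed
  next
    assume "\<forall>B. \<exists>i p L. ?R B i p L"
    \<comment> \<open>The bound B itself serves as the sequence index, so the distances p n >= n
      tend to infinity.\<close>
    then obtain i p L where R: "\<And>B. ?R B (i B) (p B) (L B)" by metis
    define r s t :: "nat \<Rightarrow> int" where "r n = int (i n) - 1" and "s n = int (i n) + int (p n) - 1"
      and "t n = int (i n) + int (p n) + int (L n) - 1" for n
    have "- 1 \<le> r n \<and> r n < s n \<and> s n < t n \<and>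
        subword a (nat (r n + 1)) (nat (r n + t n - s n)) = subword a (nat (s n + 1)) (nat (t n)) \<and>
        real_of_int (t n) \<ge> \<rho> * real_of_int (s n)" for n
    proof -
      have p: "0 < p n" and L: "0 < L n" and match: "\<forall>j<L n. a (i n + j + p n) = a (i n + j)"
        and ratio: "\<rho> * (real (i n + p n) - 1) \<le> real (i n + p n + L n) - 1"
        using R[of n] by blast+
      have "r n + t n - s n = int (i n) + int (L n) - 1" "nat (s n + 1) = i n + p n" "nat (r n + 1) = i n"
        by (auto simp: r_def s_def t_def)
      moreover have "subword a (i n) (nat (int (i n) + int (L n) - 1)) = subword a (i n + p n) (nat (t n))"
        unfolding t_def by (rule iffD2[OF subword_eq[OF L] match])
      moreover have "- 1 \<le> r n \<and> r n < s n \<and> s n < t n"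
        using p L by (simp add: r_def s_def t_def)
      moreover have "real_of_int (t n) \<ge> \<rho> * real_of_int (s n)"
        using ratio by (simp add: s_def t_def)
      ultimately show ?thesis by (simp only: simp_thms)
    qed
    moreover have "filterlim (\<lambda>n. s n - r n) at_top sequentially"
    proof (rule filterlim_at_top_mono[OF filterlim_int_sequentially])
      show "\<forall>\<^sub>F n in sequentially. int n \<le> s n - r n"
        using R by (simp add: s_def r_def)
    qed
    ultimately show "Dio_admissible a \<rho>" unfolding Dio_admissible_def by blast
  qed
qed

lemma Dio_upper:
  assumes "Dio_admissible a \<rho>"
  shows "ereal \<rho> \<le> Dio a"
  unfolding Dio_def using assms by (intro Sup_upper) auto

lemma Dio_less_infinity:
  fixes C :: real
  assumes C: "0 < C"
    and rep: "\<And>i p L. 0 < p \<Longrightarrow> (\<And>j. j < L \<Longrightarrow> a (i + j + p) = a (i + j)) \<Longrightarrow> real L \<le> C * real p"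
  shows "Dio a < \<infinity>"
proof -
  have "\<rho> \<le> 1 + 2 * C" if \<rho>: "Dio_admissible a \<rho>" for \<rho>
  proof -
    \<comment> \<open>The bound 2 excludes s = 0 and gives p <= 2 s, so L <= C p is linear in
      s.\<close>
    obtain i p L where ipL: "2 \<le> p" "0 < p" "\<forall>j<L. a (i + j + p) = a (i + j)"
        "\<rho> * (real (i + p) - 1) \<le> real (i + p + L) - 1"
      using \<rho> unfolding Dio_admissible_iff by blast
    define s where "s = real (i + p) - 1"
    have s: "0 < s" "real p \<le> 2 * s" using ipL(1) by (auto simp: s_def)
    have "\<rho> * s \<le> s + L" using ipL(4) by (simp add: s_def)
    also have "real L \<le> C * p" using rep ipL by blast
    also have "C * p \<le> C * (2 * s)" using C s by (intro mult_left_mono) auto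
    finally have "\<rho> * s \<le> (1 + 2 * C) * s" by (simp add: algebra_simps)
    then show ?thesis using s by simp
  qed
  then have "Dio a \<le> ereal (1 + 2 * C)"
    unfolding Dio_def by (intro Sup_least) auto
  then show ?thesis by (rule le_less_trans) simp
qed

lemma one_less_Dio:
  assumes \<theta>: "\<theta> \<notin> \<rat>" and pc: "piecewise_constant c \<gamma> d"
    and a: "\<And>i. a i = c (frac (real i * \<theta> + x))"
  shows "1 < Dio a"
proof -
  \<comment> \<open>The repetition found below has length l and i + q <= 2 q <= 4 l (d + 1).\<close>
  define \<rho> where "\<rho> = 1 + 1 / (4 * (real d + 1))"
  have "Dio_admissible a \<rho>"
    unfolding Dio_admissible_iff
  proof
    fix B :: nat
    \<comment> \<open>Makes q at least B and at least d + 1, so that the windows are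
      nonempty.\<close>
    define n where "n = B + d + 1"
    define q where "q = nat (cf_den \<theta> (Suc n))"
    have q: "int q = cf_den \<theta> (Suc n)" "n \<le> q"
      using cf_den_Suc_pos_mono[OF \<theta>, of n] cf_den_Suc_ge[OF \<theta>, of n] by (auto simp: q_def)
    define l where "l = q div (d + 1)"
    have l: "0 < l" using q(2) by (simp add: l_def n_def div_greater_zero_iff)
    \<comment> \<open>Rounding q down to a multiple of d + 1 loses less than d + 1 <= E, hence q <=
      2 E.\<close>
    define E where "E = l * (d + 1)"
    have "q = E + q mod (d + 1)"
      unfolding E_def l_def by (rule div_mult_mod_eq[symmetric])
    moreover have "q mod (d + 1) < d + 1" by simp
    moreover have "d + 1 \<le> E"
      unfolding E_def using mult_le_mono1[of 1 l "d + 1"] l by simp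
    ultimately have lq: "E \<le> q" and ql2: "q \<le> 2 * E" by linarith+
    have "mono (\<lambda>k. k * l)" by (rule monoI) simp
    moreover have "int (Suc d * l) \<le> cf_den \<theta> (Suc (Suc n))"
    proof -
      have "Suc d * l = E" by (simp add: E_def)
      then show ?thesis
        using cf_den_Suc_pos_mono[OF \<theta>, of "Suc n"] q lq by linarith
    qed
    ultimately obtain k where k: "k \<le> d" "\<And>i. k * l \<le> i \<Longrightarrow> i < Suc k * l \<Longrightarrow> a (i + q) = a i"
      using exists_matching_window[OF \<theta> pc a q(1), of "\<lambda>k. k * l"] by blast
    define i where "i = k * l"
    have match: "\<forall>j<l. a (i + j + q) = a (i + j)"
      using k(2) by (auto simp: i_def)
    have "i \<le> d * l" using k(1) by (simp add: i_def)
    then have "i \<le> q" using lq by (simp add: E_def algebra_simps)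
    then have "i + q \<le> 4 * E" using ql2 by linarith
    then have "real (i + q) - 1 \<le> 4 * real E" by linarith
    also have "real E = l * (real d + 1)" by (simp add: E_def algebra_simps)
    finally have "(real (i + q) - 1) / (4 * (real d + 1)) \<le> l"
      by (simp add: pos_divide_le_eq mult.left_commute)
    then have "\<rho> * (real (i + q) - 1) \<le> real (i + q + l) - 1"
      by (simp add: \<rho>_def distrib_right)
    moreover have "B \<le> q" "0 < q" using q(2) by (auto simp: n_def)
    ultimately show "\<exists>i p L. B \<le> p \<and> 0 < p \<and> 0 < L \<and> (\<forall>j<L. a (i + j + p) = a (i + j)) \<and>
      \<rho> * (real (i + p) - 1) \<le> real (i + p + L) - 1"
      using match l by blast
  qed
  then have "ereal \<rho> \<le> Dio a" by (rule Dio_upper)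
  moreover have "1 < ereal \<rho>" by (simp add: \<rho>_def one_ereal_def)
  ultimately show ?thesis by (rule less_le_trans[rotated])
qed

lemma Dio_eq_infinity:
  assumes well: "well_approximable \<theta>" and pc: "piecewise_constant c \<gamma> d"
    and a: "\<And>i. a i = c (frac (real i * \<theta> + x))"
  shows "Dio a = \<infinity>"
proof -
  have \<theta>: "\<theta> \<notin> \<rat>" using well by (simp add: well_approximable_def)
  have "Dio_admissible a (real b)" for b
    unfolding Dio_admissible_iff
  proof
    fix B :: nat
    \<comment> \<open>With q <= i, the exponent b requires b (i + q) <= 2 b i <= R i, the end of the
      window; the summand 2 keeps the window nonempty when b = 0.\<close>
    define R where "R = 2 * b + 2"
    obtain n' where n': "B + 1 < n'" "int (R ^ Suc d) \<le> partial_quotient \<theta> n'"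
      using well_approximable_large_quotient[OF well] by blast
    \<comment> \<open>The large quotient n' = \<open>Suc n\<close> is the factor from
      \<open>cf_den \<theta> (Suc n)\<close> to the next denominator, which leaves room for d + 1
      geometric windows.\<close>
    define n where "n = n' - 1"
    have n: "B < n" "int (R ^ Suc d) \<le> partial_quotient \<theta> (Suc n)" using n' by (auto simp: n_def)
    define q where "q = nat (cf_den \<theta> (Suc n))"
    have q: "int q = cf_den \<theta> (Suc n)" "n \<le> q"
      using cf_den_Suc_pos_mono[OF \<theta>, of n] cf_den_Suc_ge[OF \<theta>, of n] by (auto simp: q_def)
    have "mono (\<lambda>k. R ^ k * q)"
      by (intro monoI mult_right_mono power_increasing) (auto simp: R_def)
    moreover have "int (R ^ Suc d * q) \<le> cf_den \<theta> (Suc (Suc n))"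
    proof -
      have "int (R ^ Suc d * q) = int (R ^ Suc d) * int q" by simp
      also have "\<dots> \<le> partial_quotient \<theta> (Suc n) * int q"
        using n(2) by (intro mult_right_mono) auto
      also have "\<dots> \<le> cf_den \<theta> (Suc (Suc n))"
        using cf_den_Suc_pos_mono[OF \<theta>, of n] q(1) by simp
      finally show ?thesis .
    qed
    ultimately obtain k where k: "\<And>i. R ^ k * q \<le> i \<Longrightarrow> i < R ^ Suc k * q \<Longrightarrow> a (i + q) = a i"
      using exists_matching_window[OF \<theta> pc a q(1), of "\<lambda>k. R ^ k * q"] by blast
    define i L where "i = R ^ k * q" and "L = (R - 1) * i"
    have iL: "i + L = R ^ Suc k * q"
      by (simp add: i_def L_def R_def algebra_simps)
    have "q > 0" using n q by simp
    then have i: "q \<le> i" "0 < i" by (auto simp: i_def R_def)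
    have L: "0 < L" using i by (simp add: L_def R_def)
    have match: "\<forall>j<L. a (i + j + q) = a (i + j)"
      using k iL by (auto simp: i_def)
    have "real b * (real (i + q) - 1) \<le> real b * (2 * i)"
      using i by (intro mult_left_mono) auto
    also have "\<dots> \<le> real (R * i)" by (simp add: R_def algebra_simps)
    also have "R * i = i + L" by (simp add: L_def R_def algebra_simps)
    also have "real (i + L) \<le> real (i + q + L) - 1" using \<open>q > 0\<close> by simp
    finally have "real b * (real (i + q) - 1) \<le> real (i + q + L) - 1" .
    moreover have "B \<le> q" using n q by simp
    ultimately show "\<exists>i p L. B \<le> p \<and> 0 < p \<and> 0 < L \<and> (\<forall>j<L. a (i + j + p) = a (i + j)) \<and>
      real b * (real (i + p) - 1) \<le> real (i + p + L) - 1"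
      using match L \<open>q > 0\<close> by blast
  qed
  then have le: "ereal (real b) \<le> Dio a" for b by (rule Dio_upper)
  show ?thesis
  proof (rule ereal_top)
    fix b :: real
    have "ereal b \<le> ereal (real (nat \<lceil>b\<rceil>))" by (simp add: real_nat_ceiling_ge)
    then show "ereal b \<le> Dio a" using le order_trans by blast
  qed
qed

theorem theorem7p4:
  fixes \<theta> x :: real
    and \<Sigma> :: "'a set"
    and c :: "real \<Rightarrow> 'a"
    and \<gamma> :: "nat \<Rightarrow> real"
    and d :: nat
    and a :: "nat \<Rightarrow> 'a"
  assumes "\<theta> \<in> {0..<1}" and "\<theta> \<notin> \<rat>"
    and "finite \<Sigma>"
    and "c \<in> {0..<1} \<rightarrow> \<Sigma>"
    and "piecewise_constant c \<gamma> d"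
    and "\<not> c constant_on {0..<1}"
    and "\<And>i. a i = c (frac (real i * \<theta> + x))"
  shows "(badly_approximable \<theta> \<longrightarrow> 1 < Dio a \<and> Dio a < \<infinity>) \<and>
         (well_approximable \<theta> \<longrightarrow> Dio a = \<infinity>)"
proof (intro conjI impI)
  show "1 < Dio a" by (rule one_less_Dio[OF assms(2,5,7)])
  show "Dio a < \<infinity>" if bad: "badly_approximable \<theta>"
  proof (rule repetition_length_le[OF bad assms(5-7)])
    fix C :: real
    assume "0 < C"
      and "\<And>i p L. 0 < p \<Longrightarrow> (\<And>j. j < L \<Longrightarrow> a (i + j + p) = a (i + j)) \<Longrightarrow> real L \<le> C * real p"
    then show "Dio a < \<infinity>" by (rule Dio_less_infinity)
  qed
  show "Dio a = \<infinity>" if "well_approximable \<theta>"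
    by (rule Dio_eq_infinity[OF that assms(5,7)])
qed

end
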